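(* Let $(H,d)$ be a separable weakly proper Hadamard space that has the nice geodesic structure. Then every weakly compact set $K\subseteq H$ is weakly sequentially compact.
   Context: A Hadamard space is a complete $\mathrm{CAT}(0)$ space. For $x\in H$, $\Gamma_x(H)$ is the set of all constant speed geodesics $\gamma:[0,1]\to H$ (i.e. $d(\gamma(s),\gamma(t))=|s-t|\,d(\gamma(0),\gamma(1))$ for all $s,t\in[0,1]$) with $\gamma(0)=x$. For a geodesic $\gamma$, $P_\gamma$ denotes the metric projection onto (the image of) $\gamma$; $[x,y]$ is the geodesic segment joining $x$ and $y$ and $P_{[x,y]}$ is the metric projection onto it. Weak convergence: $x_n\overset{w}\to x$ means $P_\gamma x_n\to x$ in the metric $d$ for every $\gamma\in\Gamma_x(H)$ (no boundedness of $(x_n)$ is required). Elementary sets: for $x\in H$, $\gamma\in\Gamma_x(H)$, $\varepsilon>0$, $U_x(\varepsilon;\gamma):=\{y\in H: d(x,P_\gamma y)<\varepsilon\}$; also $U_x(\varepsilon;\gamma_1,\dots,\gamma_n):=\bigcap_{i=1}^n U_x(\varepsilon;\gamma_i)$. Weak topology $\tau_w$: a set $U\subset H$ is weakly open if for every $x\in U$ there exist $\varepsilon>0$ and finitely many $\gamma_1,\dots,\gamma_n\in\Gamma_x(H)$ with $U_x(\varepsilon;\gamma_1,\dots,\gamma_n)\subseteq U$. The weakly open sets (together with $\emptyset$) form the topology $\tau_w$ on $H$. $H$ is weakly proper if for every $x\in H$, every $\gamma\in\Gamma_x(H)$ and every $\varepsilon>0$ there exists $V\in\tau_w$ with $x\in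 V\subseteq U_x(\varepsilon;\gamma)$. Nice geodesic structure: let $H$ be separable and let $\{y_n\}_{n\in\mathbb{N}}\subset H$ be a (fixed) dense set in $H$. $H$ has the nice geodesic structure if for every $x\in H$ and every sequence $(x_k)_{k\in\mathbb{N}}$ in $H$ with $\lim_k P_{[x,y_n]}x_k=x$ for all $n\in\mathbb{N}$, one has $\lim_k P_\gamma x_k=x$ for every $\gamma\in\Gamma_x(H)$. A set $K\subseteq H$ is weakly sequentially compact if every sequence in $K$ has a subsequence converging weakly to a point of $K$. $K$ is weakly compact if every cover of $K$ by sets from $\tau_w$ has a finite subcover. *)

theory Defs
  imports "HOL-Analysis.Analysis"
begin

text \<open>Paths on the unit interval are functions on \<^typ>\<open>real\<close>; only their values on
  \<open>{0..1}\<close> are relevant, and \<^term>\<open>path_image \<gamma>\<close> is the image of \<open>{0..1}\<close>.\<close>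

definition const_speed_geodesic :: "(real \<Rightarrow> 'a::metric_space) \<Rightarrow> bool" where
  "const_speed_geodesic \<gamma> \<longleftrightarrow>
    (\<forall>s\<in>{0..1}. \<forall>t\<in>{0..1}. dist (\<gamma> s) (\<gamma> t) = \<bar>s - t\<bar> * dist (\<gamma> 0) (\<gamma> 1))"

definition geodesic_joining :: "(real \<Rightarrow> 'a::metric_space) \<Rightarrow> 'a \<Rightarrow> 'a \<Rightarrow> bool" where
  "geodesic_joining \<gamma> x y \<longleftrightarrow> const_speed_geodesic \<gamma> \<and> \<gamma> 0 = x \<and> \<gamma> 1 = y"

definition comparison_triangle ::
    "'a::metric_space \<Rightarrow> 'a \<Rightarrow> 'a \<Rightarrow> real^2 \<Rightarrow> real^2 \<Rightarrow> real^2 \<Rightarrow> bool" where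
  "comparison_triangle p q r p' q' r' \<longleftrightarrow>
    dist p' q' = dist p q \<and> dist q' r' = dist q r \<and> dist r' p' = dist r p"

text \<open>The class axiom \<open>CAT0\<close> is the comparison-triangle inequality for two points on the sides
  \<open>[p,q]\<close> and \<open>[p,r]\<close> of a geodesic triangle; the comparison points of \<open>\<alpha> s\<close> and \<open>\<beta> t\<close>
  divide the sides of the Euclidean triangle in the same ratio.
  This covers every pair of points of the triangle: two distinct sides always share a vertex,
  which may be called \<open>p\<close>, and for two points on one side the inequality is an equality.
  The third side of the triangle does not occur in the inequality.\<close>

class hadamard_space = complete_space +
  assumes geodesic_joining_exists: "\<exists>\<gamma>. geodesic_joining \<gamma> x y"
    and CAT0: "\<lbrakk>geodesic_joining \<alpha> p q; geodesic_joining \<beta> p r;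
        comparison_triangle p q r p' q' r'; s \<in> {0..1}; t \<in> {0..1}\<rbrakk>
      \<Longrightarrow> dist (\<alpha> s) (\<beta> t) \<le> dist (p' + s *\<^sub>R (q' - p')) (p' + t *\<^sub>R (r' - p'))"

definition geodesics_from :: "'a::metric_space \<Rightarrow> (real \<Rightarrow> 'a) set" where
  "geodesics_from x = {\<gamma>. const_speed_geodesic \<gamma> \<and> \<gamma> 0 = x}"

text \<open>In a Hadamard space the geodesic between two points is unique on \<open>{0..1}\<close> and the nearest
  point on a geodesic is unique, so the choice operators in the next two definitions are harmless.\<close>

definition geodesic_segment :: "'a::metric_space \<Rightarrow> 'a \<Rightarrow> 'a set" where
  "geodesic_segment x y = path_image (SOME \<gamma>. geodesic_joining \<gamma> x y)"

text \<open>\<^const>\<open>closest_point\<close> is restricted to Euclidean types; this is its definition for metric spaces.\<close>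

definition metric_projection :: "'a::metric_space set \<Rightarrow> 'a \<Rightarrow> 'a" where
  "metric_projection S y = (SOME p. p \<in> S \<and> (\<forall>q\<in>S. dist y p \<le> dist y q))"

definition weakly_converges :: "(nat \<Rightarrow> 'a::metric_space) \<Rightarrow> 'a \<Rightarrow> bool" where
  "weakly_converges X x \<longleftrightarrow>
    (\<forall>\<gamma>\<in>geodesics_from x. (\<lambda>n. metric_projection (path_image \<gamma>) (X n)) \<longlonglongrightarrow> x)"

definition elementary_set :: "'a::metric_space \<Rightarrow> real \<Rightarrow> (real \<Rightarrow> 'a) \<Rightarrow> 'a set" where
  "elementary_set x \<epsilon> \<gamma> = {y. dist x (metric_projection (path_image \<gamma>) y) < \<epsilon>}"

definition weakly_open :: "'a::metric_space set \<Rightarrow> bool" where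
  "weakly_open U \<longleftrightarrow>
    (\<forall>x\<in>U. \<exists>\<epsilon>>0. \<exists>G. finite G \<and> G \<noteq> {} \<and> G \<subseteq> geodesics_from x \<and>
      (\<Inter>\<gamma>\<in>G. elementary_set x \<epsilon> \<gamma>) \<subseteq> U)"

definition weak_topology :: "'a::metric_space topology" where
  "weak_topology = topology weakly_open"

lemma istopology_weakly_open: "istopology weakly_open"
  unfolding istopology_def
proof (intro conjI allI impI)
  fix S T :: "'a set"
  assume S: "weakly_open S" and T: "weakly_open T"
  show "weakly_open (S \<inter> T)"
    unfolding weakly_open_def
  proof
    fix x assume x: "x \<in> S \<inter> T"
    obtain \<epsilon> G where G: "\<epsilon> > 0" "finite G" "G \<noteq> {}" "G \<subseteq> geodesics_from x"
        "(\<Inter>\<gamma>\<in>G. elementary_set x \<epsilon> \<gamma>) \<subseteq> S"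
      using S x unfolding weakly_open_def by (meson IntD1)
    obtain \<delta> F where F: "\<delta> > 0" "finite F" "F \<noteq> {}" "F \<subseteq> geodesics_from x"
        "(\<Inter>\<gamma>\<in>F. elementary_set x \<delta> \<gamma>) \<subseteq> T"
      using T x unfolding weakly_open_def by (meson IntD2)
    have "(\<Inter>\<gamma>\<in>G \<union> F. elementary_set x (min \<epsilon> \<delta>) \<gamma>)
        \<subseteq> (\<Inter>\<gamma>\<in>G. elementary_set x \<epsilon> \<gamma>) \<inter> (\<Inter>\<gamma>\<in>F. elementary_set x \<delta> \<gamma>)"
      by (auto simp: elementary_set_def)
    also have "\<dots> \<subseteq> S \<inter> T"
      by (rule Int_mono[OF G(5) F(5)])
    finally show "\<exists>\<epsilon>>0. \<exists>G. finite G \<and> G \<noteq> {} \<and> G \<subseteq> geodesics_from x \<and>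
        (\<Inter>\<gamma>\<in>G. elementary_set x \<epsilon> \<gamma>) \<subseteq> S \<inter> T"
      using G(1-4) F(1-4)
      by (intro exI[of _ "min \<epsilon> \<delta>"] exI[of _ "G \<union> F"] conjI) simp_all
  qed
next
  fix \<K> :: "'a set set"
  assume K: "\<forall>S\<in>\<K>. weakly_open S"
  show "weakly_open (\<Union>\<K>)"
    unfolding weakly_open_def
  proof
    fix x assume "x \<in> \<Union>\<K>"
    then obtain S where S: "S \<in> \<K>" "x \<in> S" by blast
    with K obtain \<epsilon> G where "\<epsilon> > 0" "finite G" "G \<noteq> {}" "G \<subseteq> geodesics_from x"
        "(\<Inter>\<gamma>\<in>G. elementary_set x \<epsilon> \<gamma>) \<subseteq> S"
      unfolding weakly_open_def by meson
    moreover have "S \<subseteq> \<Union>\<K>"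
      using S(1) by (rule Union_upper)
    ultimately show "\<exists>\<epsilon>>0. \<exists>G. finite G \<and> G \<noteq> {} \<and> G \<subseteq> geodesics_from x \<and>
        (\<Inter>\<gamma>\<in>G. elementary_set x \<epsilon> \<gamma>) \<subseteq> \<Union>\<K>"
      by (intro exI[of _ \<epsilon>] exI[of _ G] conjI) (assumption | rule order_trans)+
  qed
qed

lemma openin_weak_topology: "openin weak_topology U \<longleftrightarrow> weakly_open U"
  by (simp add: weak_topology_def topology_inverse'[OF istopology_weakly_open])

lemma topspace_weak_topology [simp]: "topspace weak_topology = UNIV"
proof -
  have "weakly_open (UNIV :: 'a set)"
    unfolding weakly_open_def
  proof
    fix x :: 'a
    have "{\<lambda>_. x} \<subseteq> geodesics_from x"
      by (simp add: geodesics_from_def const_speed_geodesic_def)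
    then show "\<exists>\<epsilon>>0. \<exists>G. finite G \<and> G \<noteq> {} \<and> G \<subseteq> geodesics_from x \<and>
        (\<Inter>\<gamma>\<in>G. elementary_set x \<epsilon> \<gamma>) \<subseteq> UNIV"
      by (intro exI[of _ 1] exI[of _ "{\<lambda>_. x}"] conjI) auto
  qed
  then show ?thesis
    by (metis openin_subset openin_weak_topology top.extremum_uniqueI)
qed

definition weakly_proper :: "'a::metric_space itself \<Rightarrow> bool" where
  "weakly_proper _ \<longleftrightarrow>
    (\<forall>x::'a. \<forall>\<gamma>\<in>geodesics_from x. \<forall>\<epsilon>>0.
      \<exists>V. openin weak_topology V \<and> x \<in> V \<and> V \<subseteq> elementary_set x \<epsilon> \<gamma>)"

definition nice_geodesic_structure :: "(nat \<Rightarrow> 'a::metric_space) \<Rightarrow> bool" where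
  "nice_geodesic_structure y \<longleftrightarrow>
    (\<forall>x X. (\<forall>n. (\<lambda>k. metric_projection (geodesic_segment x (y n)) (X k)) \<longlonglongrightarrow> x) \<longrightarrow>
      (\<forall>\<gamma>\<in>geodesics_from x. (\<lambda>k. metric_projection (path_image \<gamma>) (X k)) \<longlonglongrightarrow> x))"

definition weakly_sequentially_compact :: "'a::metric_space set \<Rightarrow> bool" where
  "weakly_sequentially_compact K \<longleftrightarrow>
    (\<forall>X::nat \<Rightarrow> 'a. range X \<subseteq> K \<longrightarrow>
      (\<exists>x\<in>K. \<exists>r::nat \<Rightarrow> nat. strict_mono r \<and> weakly_converges (X \<circ> r) x))"

end

theory Submission
  imports Defs
begin

text \<open>Compactness gives every sequence in \<open>K\<close> a weak cluster point \<open>x \<in> K\<close>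
  (\<open>compactin_imp_cluster_point\<close>), but in general no subsequence need converge to it, since \<open>x\<close>
  may have no countable weak neighbourhood base. The nice geodesic structure removes this obstacle:
  to test weak convergence to \<open>x\<close> it suffices to look at the countably many segments
  \<open>[x, y n]\<close>. Convergence of the projections onto these segments concerns only the countably many
  elementary sets with radii \<open>1 / (k + 1)\<close>. Weak properness puts a weakly open neighbourhood of \<open>x\<close>
  inside each of them, and a cluster point has a subsequence that follows any prescribed sequence of
  open neighbourhoods (\<open>cluster_point_imp_subseq\<close>). Following the finite intersections of those
  neighbourhoods is a diagonal choice which works for all segments at once.\<close>

text \<open>Were there no cluster point, each point of \<open>K\<close> would have an open neighbourhood that the
  sequence eventually leaves; finitely many of them cover \<open>K\<close>, so the sequence would eventually
  leave \<open>K\<close>.\<close>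

lemma compactin_imp_cluster_point:
  fixes X :: "nat \<Rightarrow> 'a"
  assumes K: "compactin T K" and X: "range X \<subseteq> K"
  shows "\<exists>x\<in>K. \<forall>V. openin T V \<longrightarrow> x \<in> V \<longrightarrow> (\<exists>\<^sub>F n in sequentially. X n \<in> V)"
proof (rule ccontr)
  define \<U> where "\<U> = {V. openin T V \<and> (\<forall>\<^sub>F n in sequentially. X n \<notin> V)}"
  assume "\<not> ?thesis"
  then have "K \<subseteq> \<Union>\<U>"
    unfolding \<U>_def by (auto simp: not_frequently)
  moreover have "\<forall>V\<in>\<U>. openin T V"
    by (simp add: \<U>_def)
  ultimately obtain \<F> where \<F>: "finite \<F>" "\<F> \<subseteq> \<U>" "K \<subseteq> \<Union>\<F>"
    using K unfolding compactin_def by meson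
  then have "\<forall>\<^sub>F n in sequentially. \<forall>V\<in>\<F>. X n \<notin> V"
    by (intro eventually_ball_finite) (auto simp: \<U>_def)
  then obtain n where "\<forall>V\<in>\<F>. X n \<notin> V"
    by (auto dest: eventually_happens)
  then show False
    using X \<F>(3) by blast
qed

lemma cluster_point_imp_subseq:
  fixes X :: "nat \<Rightarrow> 'a"
  assumes cluster: "\<And>V. openin T V \<Longrightarrow> x \<in> V \<Longrightarrow> \<exists>\<^sub>F n in sequentially. X n \<in> V"
    and W: "\<And>k. openin T (W k)" "\<And>k. x \<in> W k"
  shows "\<exists>r::nat \<Rightarrow> nat. strict_mono r \<and> (\<forall>k. X (r k) \<in> W k)"
proof -
  have next_index: "\<exists>n\<ge>N. X n \<in> W k" for k N
    using cluster[OF W, of k] by (simp add: frequently_sequentially)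
  have "\<exists>r. \<forall>k. X (r k) \<in> W k \<and> r k < r (Suc k)"
  proof (rule dependent_nat_choice)
    show "\<exists>n. X n \<in> W 0"
      using next_index by blast
    show "\<exists>n. X n \<in> W (Suc k) \<and> m < n" for m k
      using next_index[of "Suc m" "Suc k"] by (auto simp: Suc_le_eq)
  qed
  then show ?thesis
    by (auto simp: strict_mono_Suc_iff)
qed

text \<open>The segment \<open>[x, z]\<close> is given as a set; this recovers a parametrization from \<open>x\<close>, to which
  elementary sets and weak properness apply.\<close>

lemma geodesic_segment_eq_path_image:
  fixes x z :: "'a::hadamard_space"
  obtains \<gamma> where "\<gamma> \<in> geodesics_from x" "geodesic_segment x z = path_image \<gamma>"
proof -
  have "geodesic_joining (SOME \<gamma>. geodesic_joining \<gamma> x z) x z"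
    by (rule someI_ex[OF geodesic_joining_exists])
  then show thesis
    by (intro that[of "SOME \<gamma>. geodesic_joining \<gamma> x z"])
      (auto simp: geodesic_joining_def geodesics_from_def geodesic_segment_def)
qed

theorem theorem6:
  fixes y :: "nat \<Rightarrow> 'a::hadamard_space" and K :: "'a set"
  assumes "closure (range y) = UNIV"
    and "weakly_proper TYPE('a)"
    and "nice_geodesic_structure y"
    and "compactin weak_topology K"
  shows "weakly_sequentially_compact K"
  unfolding weakly_sequentially_compact_def
proof (intro allI impI)
  fix X :: "nat \<Rightarrow> 'a"
  assume "range X \<subseteq> K"
  then obtain x where "x \<in> K"
    and cluster: "\<And>V. openin weak_topology V \<Longrightarrow> x \<in> V \<Longrightarrow> \<exists>\<^sub>F n in sequentially. X n \<in> V"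
    using compactin_imp_cluster_point[OF assms(4)] by metis
  let ?P = "\<lambda>n. metric_projection (geodesic_segment x (y n))"

  have "\<exists>V. openin weak_topology V \<and> x \<in> V \<and> (\<forall>z\<in>V. dist x (?P n z) < 1 / real (Suc k))"
    for n k
  proof -
    obtain \<gamma> where \<gamma>: "\<gamma> \<in> geodesics_from x" "geodesic_segment x (y n) = path_image \<gamma>"
      by (rule geodesic_segment_eq_path_image)
    have "1 / real (Suc k) > 0"
      by simp
    then obtain V where "openin weak_topology V" "x \<in> V"
        "V \<subseteq> elementary_set x (1 / real (Suc k)) \<gamma>"
      using assms(2)[unfolded weakly_proper_def, rule_format, OF \<gamma>(1)] by blast
    then show ?thesis
      by (auto simp: elementary_set_def \<gamma>(2))
  qed
  then obtain V where V: "\<And>n k. openin weak_topology (V n k)" "\<And>n k. x \<in> V n k"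
      "\<And>n k z. z \<in> V n k \<Longrightarrow> dist x (?P n z) < 1 / real (Suc k)"
    by metis

  \<comment> \<open>The diagonal choice: at stage \<open>k\<close> only the segments with \<open>n \<le> k\<close> are controlled, so that the
    intersection is finite and hence weakly open.\<close>
  have "\<exists>r::nat \<Rightarrow> nat. strict_mono r \<and> (\<forall>k. X (r k) \<in> (\<Inter>n\<le>k. V n k))"
  proof (rule cluster_point_imp_subseq[OF cluster])
    show "openin weak_topology (\<Inter>n\<le>k. V n k)" for k
      by (rule openin_INT2) (auto simp: V(1))
    show "x \<in> (\<Inter>n\<le>k. V n k)" for k
      using V(2) by simp
  qed auto
  then obtain r :: "nat \<Rightarrow> nat" where r: "strict_mono r" "\<And>k n. n \<le> k \<Longrightarrow> X (r k) \<in> V n k"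
    by auto

  have "(\<lambda>k. ?P n ((X \<circ> r) k)) \<longlonglongrightarrow> x" for n
  proof (rule metric_tendsto_imp_tendsto)
    show "(\<lambda>k. 1 / real (Suc k)) \<longlonglongrightarrow> 0"
      by (rule LIMSEQ_Suc[OF lim_1_over_n])
    show "\<forall>\<^sub>F k in sequentially. dist (?P n ((X \<circ> r) k)) x \<le> dist (1 / real (Suc k)) 0"
      using eventually_ge_at_top[of n]
    proof eventually_elim
      case (elim k)
      from V(3)[OF r(2)[OF elim]] show ?case
        by (simp add: dist_commute)
    qed
  qed
  then have "weakly_converges (X \<circ> r) x"
    using assms(3)[unfolded nice_geodesic_structure_def, rule_format, of x "X \<circ> r"]
    by (simp add: weakly_converges_def)
  with \<open>x \<in> K\<close> r(1)
  show "\<exists>x\<in>K. \<exists>r::nat \<Rightarrow> nat. strict_mono r \<and> weakly_converges (X \<circ> r) x"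
    by blast
qed

end
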